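(* Let $W:=W[X_1]$. If $\gamma W$ is a metric compactification of $W$, then there is a composant $P$ of $\gamma W$ such that $|W\cap P|=\mathfrak c$.
   Context: $C$ is the middle-thirds Cantor set in $[0,1]$, $\omega=\{0,1,2,\dots\}$, $\mathfrak c=2^{\omega}$ is the cardinality of the continuum, and $\mathbb Q$, $\mathbb P$ are the sets of rational and irrational real numbers. Let $C'$ be the set of all endpoints of the intervals removed from $[0,1]$ in the process of constructing $C$, and let $C''=C\setminus C'$. Let $$X_1=\big(C'\times(\mathbb Q\cap(0,1))\big)\cup\big(C''\times(\mathbb P\cap(0,1))\big)\subseteq C\times(0,1).$$ $K\subseteq[0,1]^2$ is the (rectilinear) Knaster bucket-handle continuum, $\Delta=\{\langle x,x\rangle\in K:x\in[0,1]\}$ is its diagonal Cantor set, and $K\setminus\Delta=\bigcup_{i<\omega}K_i$ is the disjoint union of open copies $K_i$ of $C\times(0,1)$, with homeomorphisms $\varphi_i:C\times(0,1)\to K_i$. Explicitly, $\Delta=\{\langle x,x\rangle:x\in C\}$, and the maps are as follows. - For $i=0$ and $c\in C$, put $x=c/3$ and $y=1-x$. Then $\varphi_0(c,t)=\langle x,\,x+2t(y-x)\rangle$ for $0<t\le 1/2$, and $\varphi_0(c,t)=\langle x+(2t-1)(y-x),\,y\rangle$ for $1/2\le t<1$. - For $i\ge1$ and $c\in C$, put $x=2/3^i+c/3^{i+1}$ and $y=5/3^i-x$. Then $\varphi_i(c,t)=\langle x+2t(y-x),\,x\rangle$ for $0<t\le1/2$, and $\varphi_i(c,t)=\langle y,\,x+(2t-1)(y-x)\rangle$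 for $1/2\le t<1$. Put $K_i=\varphi_i[C\times(0,1)]$ and $K=\Delta\cup\bigcup_{i<\omega}K_i$. For $X\subseteq C\times(0,1)$ define $W[X]=\Delta\cup\bigcup_{i<\omega}\varphi_i[X]$, with the subspace topology from $K\subseteq\mathbb R^2$. The space $W[X_1]$ is connected, so every metric compactification of it is a continuum. A metric compactification of $W$ is a compact metrizable space $\gamma W$ containing $W$ as a dense subspace. A continuum is a compact connected metrizable space. If $Y$ is a continuum, a set $P\subseteq Y$ is a *composant* of $Y$ if there exists $p\in Y$ such that $P$ is the union of all proper subcontinua of $Y$ that contain $p$. *)

theory Defs
  imports "HOL-Analysis.Analysis" "HOL-Library.Equipollence"
begin

(* The pair (a, b) stands for the closed interval {a..b}. *)
fun cantor_stage :: "nat \<Rightarrow> (real \<times> real) set" where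
  "cantor_stage 0 = {(0, 1)}"
| "cantor_stage (Suc n) =
     (\<Union>(a, b) \<in> cantor_stage n. {(a, a + (b - a) / 3), (b - (b - a) / 3, b)})"

definition cantor_set :: "real set" where
  "cantor_set = (\<Inter>n. \<Union>(a, b) \<in> cantor_stage n. {a..b})"

(* The interval removed from {a..b} is {a + (b - a) / 3 <..< b - (b - a) / 3}.
   In particular 0 and 1 are not endpoints of removed intervals. *)
definition cantor_endpoints :: "real set" where
  "cantor_endpoints =
     (\<Union>n. \<Union>(a, b) \<in> cantor_stage n. {a + (b - a) / 3, b - (b - a) / 3})"

definition X1 :: "(real \<times> real) set" where
  "X1 = cantor_endpoints \<times> (\<rat> \<inter> {0<..<1})
      \<union> (cantor_set - cantor_endpoints) \<times> ((- \<rat>) \<inter> {0<..<1})"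

(* Only the values on cantor_set \<times> {0<..<1} matter. *)
definition knaster_chart :: "nat \<Rightarrow> real \<times> real \<Rightarrow> real \<times> real" where
  "knaster_chart i = (\<lambda>(c, t).
     if i = 0 then
       (let x = c / 3; y = 1 - x in
        if t \<le> 1/2 then (x, x + 2 * t * (y - x))
        else (x + (2 * t - 1) * (y - x), y))
     else
       (let x = 2 / 3 ^ i + c / 3 ^ (i + 1); y = 5 / 3 ^ i - x in
        if t \<le> 1/2 then (x + 2 * t * (y - x), x)
        else (y, x + (2 * t - 1) * (y - x))))"

definition knaster_diagonal :: "(real \<times> real) set" where
  "knaster_diagonal = (\<lambda>x. (x, x)) ` cantor_set"

definition knaster_subset :: "(real \<times> real) set \<Rightarrow> (real \<times> real) set" where
  "knaster_subset X = knaster_diagonal \<union> (\<Union>i. knaster_chart i ` X)"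

definition knaster :: "(real \<times> real) set" where
  "knaster = knaster_subset (cantor_set \<times> {0<..<1})"

definition knaster_subspace :: "(real \<times> real) set \<Rightarrow> (real \<times> real) topology" where
  "knaster_subspace X = subtopology (top_of_set knaster) (knaster_subset X)"

(* "Y contains X as a dense subspace" is expressed through an embedding e of X in Y. *)
definition metric_compactification :: "'a topology \<Rightarrow> 'b topology \<Rightarrow> ('a \<Rightarrow> 'b) \<Rightarrow> bool" where
  "metric_compactification X Y e \<longleftrightarrow>
     compact_space Y \<and> metrizable_space Y \<and> embedding_map X Y e \<and>
     Y closure_of (e ` topspace X) = topspace Y"

definition continuum_space :: "'a topology \<Rightarrow> bool" where
  "continuum_space Y \<longleftrightarrow> compact_space Y \<and> connected_space Y \<and> metrizable_space Y"

definition proper_subcontinuum :: "'a topology \<Rightarrow> 'a set \<Rightarrow> bool" where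
  "proper_subcontinuum Y S \<longleftrightarrow> S \<subset> topspace Y \<and> continuum_space (subtopology Y S)"

(* Meaningful when Y is a continuum. *)
definition composant :: "'a topology \<Rightarrow> 'a set \<Rightarrow> bool" where
  "composant Y P \<longleftrightarrow>
     (\<exists>p \<in> topspace Y. P = \<Union> {S. proper_subcontinuum Y S \<and> p \<in> S})"

lemma cantor_stage_le: "(a, b) \<in> cantor_stage n \<Longrightarrow> a \<le> b"
  by (induction n arbitrary: a b) auto

lemma cantor_stage_left:
  assumes "(a, b) \<in> cantor_stage n"
  shows "\<exists>b'. (a, b') \<in> cantor_stage (n + k)"
proof (induction k)
  case (Suc k)
  then obtain b' where "(a, b') \<in> cantor_stage (n + k)" by blast
  then have "(a, a + (b' - a) / 3) \<in> cantor_stage (n + Suc k)" by force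
  then show ?case by blast
qed (use assms in auto)

lemma cantor_stage_right:
  assumes "(a, b) \<in> cantor_stage n"
  shows "\<exists>a'. (a', b) \<in> cantor_stage (n + k)"
proof (induction k)
  case (Suc k)
  then obtain a' where "(a', b) \<in> cantor_stage (n + k)" by blast
  then have "(b - (b - a') / 3, b) \<in> cantor_stage (n + Suc k)" by force
  then show ?case by blast
qed (use assms in auto)

lemma cantor_stage_antimono:
  assumes "m \<le> n"
  shows "(\<Union>(a, b) \<in> cantor_stage n. {a..b}) \<subseteq> (\<Union>(a, b) \<in> cantor_stage m. {a..b})"
  using assms
proof (induction n rule: dec_induct)
  case (step n)
  have "(\<Union>(a, b) \<in> cantor_stage (Suc n). {a..b}) \<subseteq> (\<Union>(a, b) \<in> cantor_stage n. {a..b})"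
  proof
    fix x assume "x \<in> (\<Union>(a, b) \<in> cantor_stage (Suc n). {a..b})"
    then obtain a b where ab: "(a, b) \<in> cantor_stage n"
      and x: "x \<in> {a..a + (b - a) / 3} \<union> {b - (b - a) / 3..b}"
      by auto
    have "x \<in> {a..b}"
      using x cantor_stage_le[OF ab] by (auto simp: field_simps)
    with ab show "x \<in> (\<Union>(a, b) \<in> cantor_stage n. {a..b})" by blast
  qed
  with step.IH show ?case by blast
qed simp

lemma cantor_stage_endpoints:
  assumes "(a, b) \<in> cantor_stage n"
  shows "a \<in> cantor_set" "b \<in> cantor_set"
proof -
  have "a \<in> (\<Union>(a, b) \<in> cantor_stage m. {a..b}) \<and> b \<in> (\<Union>(a, b) \<in> cantor_stage m. {a..b})" for m
  proof -
    obtain a' b' where "(a, b') \<in> cantor_stage (n + m)" "(a', b) \<in> cantor_stage (n + m)"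
      using cantor_stage_left[OF assms] cantor_stage_right[OF assms] by blast
    then have "a \<in> (\<Union>(a, b) \<in> cantor_stage (n + m). {a..b})"
      "b \<in> (\<Union>(a, b) \<in> cantor_stage (n + m). {a..b})"
      using cantor_stage_le by fastforce+
    then show ?thesis using cantor_stage_antimono[of m "n + m"] by auto
  qed
  then show "a \<in> cantor_set" "b \<in> cantor_set" by (auto simp: cantor_set_def)
qed

lemma cantor_endpoints_subset: "cantor_endpoints \<subseteq> cantor_set"
proof
  fix x assume "x \<in> cantor_endpoints"
  then obtain n a b where "(a, b) \<in> cantor_stage n"
    and "x = a + (b - a) / 3 \<or> x = b - (b - a) / 3"
    by (auto simp: cantor_endpoints_def)
  then have "(a, x) \<in> cantor_stage (Suc n) \<or> (x, b) \<in> cantor_stage (Suc n)" by force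
  then show "x \<in> cantor_set" using cantor_stage_endpoints by blast
qed

lemma X1_subset: "X1 \<subseteq> cantor_set \<times> {0<..<1}"
  using cantor_endpoints_subset by (auto simp: X1_def)

lemma knaster_subset_mono: "X \<subseteq> X' \<Longrightarrow> knaster_subset X \<subseteq> knaster_subset X'"
  unfolding knaster_subset_def by blast

lemma topspace_knaster_subspace_X1: "topspace (knaster_subspace X1) = knaster_subset X1"
  using knaster_subset_mono[OF X1_subset] by (auto simp: knaster_subspace_def knaster_def)

end

theory Submission
  imports Defs
begin

text \<open>
  Fix an interval \<open>{a..b}\<close> inside \<open>(0, 1)\<close>. The part of \<open>X1\<close> of height between \<open>a\<close> and \<open>b\<close> cannot
  be cut by a clopen set that separates two points of the same vertical fibre. This is the Baire
  category argument of Knaster and Kuratowski, \<open>vertical_fibre_in_quasi_component\<close>.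

  A quasi-component survives continuous maps, and in a compact Hausdorff space it is connected. Hence,
  if \<open>f\<close> maps a space into the compactification \<open>Y\<close> and its image is not dense, then each
  quasi-component of the space is carried into a single component of the closure of the image, and
  that component is a proper subcontinuum of \<open>Y\<close> (\<open>quasi_component_imp_proper_subcontinuum\<close>).

  Apply this to \<open>f = e \<circ> knaster_chart 0\<close> on the points of \<open>X1\<close> whose height lies in \<open>{1/8..3/8}\<close>. The
  image is not dense, because the chart sends these points to the left half of the square, away from
  the diagonal point \<open>(1, 1)\<close>, and \<open>e\<close> is a homeomorphism onto its image. Over the point \<open>0\<close> of the Cantor set, which
  is not an endpoint of a removed interval, the fibre consists of the irrationals of \<open>{1/8..3/8}\<close>.
  So any two of continuum many points of the copy of \<open>W\<close> lie in a common proper subcontinuum, and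
  the composant of one of them contains all of them.
\<close>

section \<open>Sets of cardinality continuum\<close>

text \<open>
  Uncountability of the irrationals would not determine their cardinality. Cardinal arithmetic
  does: \<open>A\<close> is covered by \<open>A - B\<close> and a countable set, and adding to an infinite set one that is no
  larger does not change its size.
\<close>

lemma lepoll_Diff_countable:
  assumes "countable B" "infinite (A - B)"
  shows "A \<lesssim> A - B"
proof -
  have "A \<inter> B \<lesssim> (UNIV :: nat set)"
    using assms(1) by (meson countable_Int2 countable_def lepoll_def subset_UNIV)
  also have "(UNIV :: nat set) \<lesssim> A - B"
    using assms(2) infinite_le_lepoll by blast
  finally have small: "A \<inter> B \<lesssim> A - B" .
  have "inj_on (\<lambda>x. if x \<in> B then Inr x else Inl x) A"
    by (auto simp: inj_on_def split: if_splits)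
  then have "A \<lesssim> (A - B) <+> (A \<inter> B)"
    unfolding lepoll_def by (intro exI conjI) auto
  also have "(A - B) <+> (A \<inter> B) \<approx> A - B"
    using small assms(2) unfolding eqpoll_iff_card_of_ordIso lepoll_def
    by (simp add: card_of_Plus_infinite1 flip: card_of_ordLeq)
  finally show ?thesis .
qed

lemma reals_lepoll_irrationals:
  fixes a b :: real
  assumes "a < b"
  shows "(UNIV :: real set) \<lesssim> {a..b} - \<rat>"
proof -
  have "uncountable ({a..b} - \<rat>)"
    using assms by (simp add: countable_rat uncountable_closed_interval uncountable_minus_countable)
  then have "{a..b} \<lesssim> {a..b} - \<rat>"
    by (intro lepoll_Diff_countable countable_rat) (auto dest: countable_finite)
  then show ?thesis
    using assms closed_interval_eqpoll_reals eqpoll_sym lepoll_trans1 by blast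
qed

section \<open>The Cantor set\<close>

lemma cantor_stage_length: "(a, b) \<in> cantor_stage n \<Longrightarrow> b - a = 1 / 3 ^ n"
proof (induction n arbitrary: a b)
  case (Suc n)
  then obtain c d where "(c, d) \<in> cantor_stage n" "b - a = (d - c) / 3"
    by auto
  then show ?case
    using Suc.IH[of c d] by simp
qed auto

lemma cantor_stage_nonneg: "(a, b) \<in> cantor_stage n \<Longrightarrow> 0 \<le> a"
proof (induction n arbitrary: a b)
  case (Suc n)
  then obtain c d where "(c, d) \<in> cantor_stage n" "a = c \<or> a = d - (d - c) / 3"
    by auto
  then show ?case
    using Suc.IH[of c d] cantor_stage_le[of c d n] by (auto simp: field_simps)
qed auto

lemma finite_cantor_stage: "finite (cantor_stage n)"
  by (induction n) auto

lemma closed_cantor_set: "closed cantor_set"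
  unfolding cantor_set_def by (auto intro!: closed_INT closed_UN finite_cantor_stage)

lemma countable_cantor_endpoints: "countable cantor_endpoints"
  unfolding cantor_endpoints_def
  by (auto intro!: countable_UN countable_finite[OF finite_cantor_stage])

lemma zero_in_cantor_set: "0 \<in> cantor_set"
  using cantor_stage_endpoints(1)[of 0 1 0] by simp

lemma zero_not_in_cantor_endpoints: "0 \<notin> cantor_endpoints"
proof
  assume "0 \<in> cantor_endpoints"
  then obtain n a b where ab: "(a, b) \<in> cantor_stage n"
    and zero: "0 = a + (b - a) / 3 \<or> 0 = b - (b - a) / 3"
    by (auto simp: cantor_endpoints_def)
  have "0 \<le> a" "0 < b - a"
    using cantor_stage_nonneg[OF ab] cantor_stage_length[OF ab] by simp_all
  then have "0 < a + (b - a) / 3" "0 < b - (b - a) / 3"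
    by (simp_all add: field_simps)
  with zero show False
    by linarith
qed

text \<open>
  The two ends of one removed interval serve as approximations: at least one of them differs
  from \<open>x\<close>. So the removed intervals give both the density of their endpoints and the absence of
  isolated points.
\<close>

lemma islimpt_cantor_endpoints:
  assumes "x \<in> cantor_set"
  shows "x islimpt cantor_endpoints"
  unfolding islimpt_approachable
proof (intro allI impI)
  fix \<epsilon> :: real
  assume "0 < \<epsilon>"
  then obtain n where n: "(1 / 3) ^ n < \<epsilon>"
    using real_arch_pow_inv[of \<epsilon> "1 / 3"] by auto
  obtain a b where ab: "(a, b) \<in> cantor_stage n" "x \<in> {a..b}"
    using assms unfolding cantor_set_def by blast
  have len: "b - a < \<epsilon>" "0 < b - a"
    using n cantor_stage_length[OF ab(1)] by (auto simp: power_divide)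
  let ?l = "a + (b - a) / 3" and ?r = "b - (b - a) / 3"
  have "?l \<in> cantor_endpoints" "?r \<in> cantor_endpoints"
    using ab(1) by (force simp: cantor_endpoints_def)+
  moreover have "dist ?l x < \<epsilon>" "dist ?r x < \<epsilon>" "?l \<noteq> ?r"
    using ab(2) len by (auto simp: dist_real_def abs_if field_simps)
  ultimately show "\<exists>x'\<in>cantor_endpoints. x' \<noteq> x \<and> dist x' x < \<epsilon>"
    by metis
qed

section \<open>Quasi-components of Knaster--Kuratowski sets\<close>

lemma interval_subset_closure_rationals:
  fixes a b :: real
  assumes "a < b"
  shows "{a..b} \<subseteq> closure ({a..b} \<inter> \<rat>)" "{a..b} \<subseteq> closure ({a..b} - \<rat>)"
proof -
  have "\<exists>q. q \<in> \<rat> \<and> x < q \<and> q < y" if "x < y" for x y :: real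
    using Rats_dense_in_real[OF that] by blast
  moreover have "\<exists>q. q \<notin> \<rat> \<and> x < q \<and> q < y" if "x < y" for x y :: real
  proof -
    have "uncountable ({x<..<y} - \<rat>)"
      using that by (simp add: countable_rat uncountable_open_interval uncountable_minus_countable)
    then have "{x<..<y} - \<rat> \<noteq> {}" by (metis countable_empty)
    then show ?thesis by auto
  qed
  moreover have "{a..b} \<subseteq> closure ({a..b} \<inter> F)"
    if F: "\<And>x y :: real. x < y \<Longrightarrow> \<exists>q. q \<in> F \<and> x < q \<and> q < y" for F
  proof
    fix r
    assume r: "r \<in> {a..b}"
    show "r \<in> closure ({a..b} \<inter> F)"
      unfolding closure_approachable
    proof (intro allI impI)
      fix \<epsilon> :: real
      assume "0 < \<epsilon>"
      then have "max a (r - \<epsilon>) < min b (r + \<epsilon>)"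
        using r assms by auto
      then obtain q where "q \<in> F" "max a (r - \<epsilon>) < q" "q < min b (r + \<epsilon>)"
        using F by blast
      then show "\<exists>q\<in>{a..b} \<inter> F. dist q r < \<epsilon>"
        by (auto simp: dist_real_def abs_if intro!: bexI[of _ q])
    qed
  qed
  ultimately show "{a..b} \<subseteq> closure ({a..b} \<inter> \<rat>)" "{a..b} \<subseteq> closure ({a..b} - \<rat>)"
    by (simp_all add: Diff_eq)
qed

text \<open>
  Suppose that a clopen partition \<open>U\<close>, \<open>V\<close> of \<open>X\<close> separates \<open>(c, s)\<close> from \<open>(c, t)\<close>, and let
  \<open>L = closure U \<inter> closure V\<close>. This closed set misses \<open>X\<close>. For every \<open>d\<close> of \<open>C\<close> close to \<open>c\<close>, the
  segment over \<open>d\<close> is connected, is covered by the two closures and meets both; so it meets \<open>L\<close>, and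
  for \<open>d\<close> outside \<open>D\<close> it does so at a rational height. Hence a neighbourhood of \<open>c\<close> in \<open>C\<close> is covered
  by the points of \<open>D\<close> and by the horizontal sections of \<open>L\<close> at rational heights. These are countably
  many closed sets with empty interior, since a section at a rational height misses the dense
  set \<open>D\<close>. That contradicts Baire's theorem.
\<close>

lemma vertical_fibre_in_quasi_component:
  fixes C D :: "'a::complete_space set" and a b :: real
  assumes "closed C" "countable D" "D \<subseteq> C"
    and dense: "\<And>x. x \<in> C \<Longrightarrow> x islimpt D"
    and "a < b"
    and X: "X = D \<times> ({a..b} \<inter> \<rat>) \<union> (C - D) \<times> ({a..b} - \<rat>)"
    and cs: "(c, s) \<in> X" and ct: "(c, t) \<in> X"
  shows "quasi_component_of (top_of_set X) (c, s) (c, t)"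
  unfolding quasi_component_of_alt
proof (intro conjI notI)
  show "(c, s) \<in> topspace (top_of_set X)" "(c, t) \<in> topspace (top_of_set X)"
    using cs ct by simp_all
next
  assume "\<exists>U V. openin (top_of_set X) U \<and> openin (top_of_set X) V \<and>
            U \<union> V = topspace (top_of_set X) \<and> disjnt U V \<and> (c, s) \<in> U \<and> (c, t) \<in> V"
  then obtain U V where UV: "openin (top_of_set X) U" "openin (top_of_set X) V"
    and part: "U \<union> V = X" "U \<inter> V = {}" "(c, s) \<in> U" "(c, t) \<in> V"
    by (auto simp: disjnt_def)
  from UV obtain U' V' where U': "open U'" "U = X \<inter> U'" and V': "open V'" "V = X \<inter> V'"
    by (auto simp: openin_open)
  define L where "L = closure U \<inter> closure V"
  have "closed L" by (simp add: L_def closed_Int)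
  have "U' \<inter> closure V = {}" "V' \<inter> closure U = {}"
    using part(2) U' V' open_Int_closure_eq_empty[of U' V] open_Int_closure_eq_empty[of V' U]
    by auto
  then have LX: "L \<inter> X = {}"
    using part U' V' by (auto simp: L_def)
  have "(c, s) \<in> U'" "(c, t) \<in> V'"
    using part U' V' by auto
  obtain N1 I1 where N1: "open N1" "open I1" "(c, s) \<in> N1 \<times> I1" "N1 \<times> I1 \<subseteq> U'"
    using U'(1) \<open>(c, s) \<in> U'\<close> by (rule open_prod_elim)
  obtain N2 I2 where N2: "open N2" "open I2" "(c, t) \<in> N2 \<times> I2" "N2 \<times> I2 \<subseteq> V'"
    using V'(1) \<open>(c, t) \<in> V'\<close> by (rule open_prod_elim)
  define N where "N = N1 \<inter> N2"
  have "open N" "c \<in> N" using N1 N2 by (auto simp: N_def)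
  have st: "c \<in> C" "s \<in> {a..b}" "t \<in> {a..b}"
    using cs ct \<open>D \<subseteq> C\<close> by (auto simp: X)
  have meets: "\<exists>r\<in>{a..b}. (d, r) \<in> L" if d: "d \<in> C" "d \<in> N" for d
  proof -
    \<comment> \<open>the heights at which the segment over \<open>d\<close> meets \<open>X\<close>; they are dense in \<open>{a..b}\<close>\<close>
    define F where "F = (if d \<in> D then {a..b} \<inter> \<rat> else {a..b} - \<rat>)"
    have FX: "{d} \<times> F \<subseteq> X"
      using d by (auto simp: F_def X)
    have Fcl: "{a..b} \<subseteq> closure F"
      using interval_subset_closure_rationals[OF \<open>a < b\<close>] by (simp add: F_def)
    define SU where "SU = Pair d -` closure U"
    define SV where "SV = Pair d -` closure V"
    have cl: "closed SU" "closed SV"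
      unfolding SU_def SV_def by (auto intro!: closed_vimage continuous_intros)
    have "F \<subseteq> SU \<union> SV"
    proof
      fix r
      assume "r \<in> F"
      then have "(d, r) \<in> U \<or> (d, r) \<in> V"
        using FX part(1) by blast
      then show "r \<in> SU \<union> SV"
        using closure_subset by (auto simp: SU_def SV_def)
    qed
    then have cover: "{a..b} \<subseteq> SU \<union> SV"
      using Fcl cl closure_minimal[of F "SU \<union> SV"] by blast
    have "I1 \<inter> F \<noteq> {}" "I2 \<inter> F \<noteq> {}"
      using N1 N2 st Fcl open_Int_closure_eq_empty[of I1 F] open_Int_closure_eq_empty[of I2 F]
      by auto
    then obtain r1 r2 where "r1 \<in> I1" "r1 \<in> F" "r2 \<in> I2" "r2 \<in> F" by blast
    then have r: "(d, r1) \<in> U" "(d, r2) \<in> V"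
      using d FX N1 N2 U' V' by (auto simp: N_def)
    have "F \<subseteq> {a..b}" by (auto simp: F_def)
    then have "SU \<inter> {a..b} \<noteq> {}" "SV \<inter> {a..b} \<noteq> {}"
      using r \<open>r1 \<in> F\<close> \<open>r2 \<in> F\<close> closure_subset[of U] closure_subset[of V]
      unfolding SU_def SV_def by blast+
    then have "SU \<inter> SV \<inter> {a..b} \<noteq> {}"
      using connected_Icc[of a b] cl cover unfolding connected_closed by blast
    then show ?thesis
      by (auto simp: SU_def SV_def L_def)
  qed
  define slice where "slice r = {d \<in> C. (d, r) \<in> L}" for r
  let ?\<G> = "slice ` ({a..b} \<inter> \<rat>) \<union> (\<lambda>d. {d}) ` D"
  have "(top_of_set C) interior_of (\<Union>?\<G>) = {}"
  proof (rule Baire_category_alt)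
    show "completely_metrizable_space (top_of_set C) \<or>
        locally_compact_space (top_of_set C) \<and> regular_space (top_of_set C)"
      using \<open>closed C\<close> completely_metrizable_space_closedin completely_metrizable_space_euclidean
      by (metis closed_closedin)
    show "countable ?\<G>"
      using \<open>countable D\<close> by (auto intro: countable_Int2 countable_rat)
    show "closedin (top_of_set C) T \<and> (top_of_set C) interior_of T = {}" if T: "T \<in> ?\<G>" for T
    proof
      have "closed ((\<lambda>d. (d, r)) -` L)" for r
        using \<open>closed L\<close> by (auto intro!: closed_vimage continuous_intros)
      moreover have "slice r = C \<inter> (\<lambda>d. (d, r)) -` L" for r
        by (auto simp: slice_def)
      ultimately have "closed (slice r)" for r
        using \<open>closed C\<close> by (simp add: closed_Int)
      moreover have "slice r \<subseteq> C" for r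
        by (auto simp: slice_def)
      ultimately show "closedin (top_of_set C) T"
        using T \<open>D \<subseteq> C\<close> by (auto intro!: closed_subset)
      have False if x: "x \<in> (top_of_set C) interior_of T" for x
      proof -
        obtain O' where O': "open O'" "x \<in> C" "x \<in> O'" "C \<inter> O' \<subseteq> T"
          using x by (auto simp: interior_of_def openin_open)
        then obtain d where d: "d \<in> D" "d \<in> O'" "d \<noteq> x"
          using dense[OF \<open>x \<in> C\<close>] unfolding islimpt_def by blast
        then have "d \<in> T" "x \<in> T"
          using O' \<open>D \<subseteq> C\<close> by auto
        with T \<open>d \<noteq> x\<close> obtain r where "r \<in> {a..b} \<inter> \<rat>" "(d, r) \<in> L"
          by (auto simp: slice_def)
        with \<open>d \<in> D\<close> LX show False
          by (auto simp: X)
      qed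
      then show "(top_of_set C) interior_of T = {}" by blast
    qed
  qed
  moreover have "C \<inter> N \<subseteq> (top_of_set C) interior_of (\<Union>?\<G>)"
  proof (rule interior_of_maximal)
    show "C \<inter> N \<subseteq> \<Union>?\<G>"
    proof
      fix d
      assume d: "d \<in> C \<inter> N"
      then obtain r where r: "r \<in> {a..b}" "(d, r) \<in> L"
        using meets by blast
      show "d \<in> \<Union>?\<G>"
      proof (cases "d \<in> D")
        case False
        then have "r \<in> \<rat>"
          using r d LX by (auto simp: X)
        then show ?thesis
          using r d by (auto simp: slice_def)
      qed auto
    qed
    show "openin (top_of_set C) (C \<inter> N)"
      using \<open>open N\<close> by (simp add: openin_open_Int)
  qed
  ultimately show False
    using \<open>c \<in> N\<close> \<open>c \<in> C\<close> by blast
qed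

section \<open>From quasi-components to subcontinua\<close>

text \<open>
  The subcontinuum is a component of the closure \<open>A\<close> of the image. It contains both points because
  \<open>A\<close> is compact and Hausdorff, so that its components are its quasi-components; passing to \<open>A\<close>
  instead of \<open>Y\<close> makes it proper.
\<close>

lemma quasi_component_imp_proper_subcontinuum:
  assumes "compact_space Y" "metrizable_space Y" "continuous_map X Y f"
    and "quasi_component_of X x y"
    and "Y closure_of (f ` topspace X) \<noteq> topspace Y"
  obtains S where "proper_subcontinuum Y S" "f x \<in> S" "f y \<in> S"
proof -
  define A where "A = Y closure_of (f ` topspace X)"
  let ?Z = "subtopology Y A"
  have A: "A \<subset> topspace Y" "closedin Y A"
    using assms(5) closure_of_subset_topspace[of Y] by (auto simp: A_def)
  have top: "topspace ?Z = A"
    using A by auto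
  have "f ` topspace X \<subseteq> A"
    unfolding A_def using assms(3) by (simp add: closure_of_subset continuous_map_image_subset_topspace)
  then have "continuous_map X ?Z f"
    using assms(3) by (auto simp: continuous_map_in_subtopology)
  then have "quasi_component_of ?Z (f x) (f y)"
    using assms(4) by (rule quasi_component_of_continuous_image)
  moreover have "compact_space ?Z"
    using A(2) assms(1) by (simp add: closedin_compact_space compact_space_subtopology)
  moreover have "Hausdorff_space ?Z"
    using assms(2) by (simp add: Hausdorff_space_subtopology metrizable_imp_Hausdorff_space)
  ultimately have xy: "connected_component_of ?Z (f x) (f y)"
    by (simp flip: quasi_eq_connected_component_of)
  define S where "S = connected_component_of_set ?Z (f x)"
  have "S \<subseteq> A"
    using connected_component_of_subset_topspace[of ?Z] top by (auto simp: S_def)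
  have "compactin ?Z S" "connectedin ?Z S"
    unfolding S_def
    by (simp_all add: \<open>compact_space ?Z\<close> closedin_compact_space closedin_connected_component_of
        connectedin_connected_component_of)
  then have "compact_space (subtopology Y S)" "connected_space (subtopology Y S)"
    using \<open>S \<subseteq> A\<close>
    by (auto simp: compactin_subspace connectedin_def subtopology_subtopology inf.absorb2)
  then have "proper_subcontinuum Y S"
    using A(1) \<open>S \<subseteq> A\<close> assms(2)
    by (auto simp: proper_subcontinuum_def continuum_space_def metrizable_space_subtopology)
  moreover have "f x \<in> S" "f y \<in> S"
    using xy connected_component_of_equiv[of ?Z "f x" "f y"]
    unfolding S_def by (metis mem_Collect_eq connected_component_of_refl)+
  ultimately show thesis
    by (rule that)
qed

section \<open>The composant\<close>

text \<open>
  Heights at most \<open>1/2\<close> stay on the first branch of the chart. There it is a polynomial, from which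
  continuity, injectivity on the fibre over \<open>0\<close> and the distance to \<open>(1, 1)\<close> can be read off.
\<close>

lemma knaster_chart_0:
  assumes "t \<le> 1/2"
  shows "knaster_chart 0 (c, t) = (c / 3, c / 3 + 2 * t * (1 - 2 * (c / 3)))"
  using assms by (simp add: knaster_chart_def Let_def)

lemma diagonal_point_in_knaster_subset: "(1, 1) \<in> knaster_subset X"
  using cantor_stage_endpoints(2)[of 0 1 0] by (auto simp: knaster_subset_def knaster_diagonal_def)

lemma knaster_subspace_X1: "knaster_subspace X1 = top_of_set (knaster_subset X1)"
  using knaster_subset_mono[OF X1_subset]
  by (simp add: knaster_subspace_def knaster_def subtopology_subtopology inf.absorb2)

theorem theorem1:
  fixes Y :: "'b topology" and e :: "real \<times> real \<Rightarrow> 'b"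
  assumes "metric_compactification (knaster_subspace X1) Y e"
  shows "\<exists>P. composant Y P \<and> e ` knaster_subset X1 \<inter> P \<approx> (UNIV :: real set)"
proof -
  define W where "W = knaster_subset X1"
  have Y: "compact_space Y" "metrizable_space Y" and emb: "embedding_map (top_of_set W) Y e"
    using assms by (auto simp: metric_compactification_def knaster_subspace_X1 W_def)
  have homeo: "homeomorphic_map (top_of_set W) (subtopology Y (e ` W)) e"
    using emb by (simp add: embedding_map_def)
  have inj: "inj_on e W"
    using homeomorphic_imp_injective_map[OF homeo] by simp
  have econt: "continuous_map (top_of_set W) Y e"
    using continuous_map_into_fulltopology homeo homeomorphic_imp_continuous_map by blast
  have eW: "e ` W \<subseteq> topspace Y"
    using continuous_map_image_subset_topspace[OF econt] by simp
  define Z where "Z = cantor_endpoints \<times> ({1/8..3/8} \<inter> \<rat>) \<union>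
    (cantor_set - cantor_endpoints) \<times> ({1/8..3/8::real} - \<rat>)"
  have ZX1: "Z \<subseteq> X1" by (auto simp: Z_def X1_def)
  define \<phi> where "\<phi> = knaster_chart 0"
  have \<phi>W: "\<phi> ` Z \<subseteq> W"
    using ZX1 by (auto simp: \<phi>_def W_def knaster_subset_def)
  have "continuous_on Z (\<lambda>p. (fst p / 3, fst p / 3 + 2 * snd p * (1 - 2 * (fst p / 3))))"
    by (intro continuous_intros) auto
  then have "continuous_on Z \<phi>"
    by (rule continuous_on_eq) (auto simp: \<phi>_def knaster_chart_0 Z_def)
  then have "continuous_map (top_of_set Z) (top_of_set W) \<phi>"
    using \<phi>W by auto
  then have fcont: "continuous_map (top_of_set Z) Y (e \<circ> \<phi>)"
    using econt by (rule continuous_map_compose)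
  have not_dense: "Y closure_of ((e \<circ> \<phi>) ` topspace (top_of_set Z)) \<noteq> topspace Y"
  proof -
    have "openin (top_of_set W) (W \<inter> {p. 1/2 < fst p})"
      by (intro openin_open_Int open_Collect_less continuous_intros)
    then have "openin (subtopology Y (e ` W)) (e ` (W \<inter> {p. 1/2 < fst p}))"
      using homeomorphic_imp_open_map[OF homeo] by (simp add: open_map_def)
    then obtain G where G: "openin Y G" "e ` (W \<inter> {p. 1/2 < fst p}) = G \<inter> e ` W"
      by (auto simp: openin_subtopology)
    \<comment> \<open>The neighbourhood \<open>{p. 1/2 < fst p}\<close> of \<open>(1, 1)\<close> is missed by the image of the chart.\<close>
    have left: "fst p \<le> 1/2" if "p \<in> \<phi> ` Z" for p
    proof -
      from that obtain c t where "(c, t) \<in> Z" "p = (c / 3, c / 3 + 2 * t * (1 - 2 * (c / 3)))"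
        by (auto simp: \<phi>_def knaster_chart_0 Z_def)
      moreover have "c \<le> 1" if "c \<in> cantor_set" for c
        using that INT_D[of c "\<lambda>n. \<Union>(a, b)\<in>cantor_stage n. {a..b}" UNIV 0]
        unfolding cantor_set_def by simp
      ultimately show ?thesis
        using cantor_endpoints_subset by (force simp: Z_def)
    qed
    have "G \<inter> (e \<circ> \<phi>) ` Z = {}"
    proof (rule ccontr)
      assume "G \<inter> (e \<circ> \<phi>) ` Z \<noteq> {}"
      then obtain z where "z \<in> Z" "e (\<phi> z) \<in> G" by (auto simp del: split_paired_Ex)
      then obtain p where p: "p \<in> \<phi> ` Z" "e p \<in> G" by blast
      then have "p \<in> W" "e p \<in> e ` (W \<inter> {p. 1/2 < fst p})"
        using G \<phi>W by blast+
      then have "1/2 < fst p"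
        using inj_on_image_mem_iff[OF inj, of p "W \<inter> {p. 1/2 < fst p}"] by simp
      then show False
        using left[OF p(1)] by simp
    qed
    moreover have "e (1, 1) \<in> G"
      using G diagonal_point_in_knaster_subset[of X1] by (force simp: W_def)
    ultimately have "e (1, 1) \<notin> Y closure_of ((e \<circ> \<phi>) ` Z)"
      using G(1) by (auto simp: in_closure_of)
    moreover have "e (1, 1) \<in> topspace Y"
      using eW diagonal_point_in_knaster_subset[of X1] by (auto simp: W_def)
    ultimately show ?thesis by auto
  qed
  define T where "T = {1/8..3/8::real} - \<rat>"
  have card_T: "(UNIV :: real set) \<lesssim> T"
    unfolding T_def by (rule reals_lepoll_irrationals) simp
  then have "T \<noteq> {}" by auto
  then obtain s where s: "s \<in> T" by blast
  have fibre: "(0, t) \<in> Z" if "t \<in> T" for t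
    using that zero_in_cantor_set zero_not_in_cantor_endpoints by (auto simp: Z_def T_def)
  define f where "f t = e (\<phi> (0, t))" for t
  have f_in: "f t \<in> e ` W" if "t \<in> T" for t
    using fibre[OF that] \<phi>W by (auto simp: f_def)
  define P where "P = \<Union> {S. proper_subcontinuum Y S \<and> f s \<in> S}"
  have "composant Y P"
    unfolding composant_def P_def using f_in[OF s] eW by blast
  have "f ` T \<subseteq> e ` W \<inter> P"
  proof clarify
    fix t
    assume t: "t \<in> T"
    have "quasi_component_of (top_of_set Z) (0, s) (0, t)"
      by (rule vertical_fibre_in_quasi_component[OF closed_cantor_set countable_cantor_endpoints
            cantor_endpoints_subset islimpt_cantor_endpoints _ Z_def fibre[OF s] fibre[OF t]])
        simp_all
    then obtain S where "proper_subcontinuum Y S" "(e \<circ> \<phi>) (0, s) \<in> S" "(e \<circ> \<phi>) (0, t) \<in> S"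
      using quasi_component_imp_proper_subcontinuum[OF Y fcont _ not_dense] by blast
    then show "f t \<in> e ` W \<inter> P"
      using f_in[OF t] by (auto simp: f_def P_def)
  qed
  moreover have "inj_on f T"
  proof (rule inj_onI)
    fix t t'
    assume *: "t \<in> T" "t' \<in> T" "f t = f t'"
    then have "\<phi> (0, t) = \<phi> (0, t')"
      using inj_onD[OF inj] fibre \<phi>W unfolding f_def by (metis image_subset_iff)
    then show "t = t'"
      using * by (auto simp: \<phi>_def knaster_chart_0 T_def)
  qed
  ultimately have "T \<lesssim> e ` W \<inter> P"
    by (auto simp: lepoll_def)
  then have lower: "(UNIV :: real set) \<lesssim> e ` W \<inter> P"
    using card_T lepoll_trans by blast
  \<comment> \<open>The upper bound comes from the plane, which contains \<open>W\<close>.\<close>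
  have "e ` W \<inter> P \<lesssim> e ` W"
    by (simp add: subset_imp_lepoll)
  also have "e ` W \<lesssim> (UNIV :: (real \<times> real) set)"
    by (meson image_lepoll lepoll_trans subset_UNIV subset_imp_lepoll)
  also have "(UNIV :: (real \<times> real) set) \<approx> (UNIV :: real set)"
    using card_of_Times_same_infinite[of "UNIV :: real set"]
    by (simp add: eqpoll_iff_card_of_ordIso infinite_UNIV_char_0)
  finally have "e ` W \<inter> P \<lesssim> (UNIV :: real set)" .
  with lower have "e ` W \<inter> P \<approx> (UNIV :: real set)"
    by (simp add: lepoll_antisym)
  with \<open>composant Y P\<close> show ?thesis
    unfolding W_def by blast
qed

end
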